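(* Let $V$ be a euclidean space of dimension $n$ and let $c:[a,b]\to V$ be a strongly regular curve. 1. The functions $\|c'(t)\|,\dots,\|c^{(n)}(t)\|$ determine the curve up to an isometry of $V$ (not necessarily orientation preserving). That is, if $\tilde c:[a,b]\to V$ is a strongly regular curve with $\|\tilde c^{(k)}(t)\|=\|c^{(k)}(t)\|$ for all $t\in[a,b]$ and $1\le k\le n$, then there is an isometry $g$ of $V$ such that $\tilde c(t)=g(c(t))$ for all $t\in[a,b]$. 2. The functions $\|c'(t)\|,\dots,\|c^{(n)}(t)\|$ and the number $\mathrm{sgn}(c)\in\{1,-1\}$ determine the curve up to an orientation preserving isometry of $V$. That is, if in addition to the conditions in 1 we have $\mathrm{sgn}(\tilde c)=\mathrm{sgn}(c)$, then $g$ can be chosen orientation preserving.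
   Context: A euclidean space is a finite-dimensional, oriented, real vector space $V$ with a positive definite scalar product. A curve $c:[a,b]\to V$ ($a<b$, $\dim V=n$) is strongly regular if it is $n$ times continuously differentiable and the $n$ vectors $c'(t),\dots,c^{(n)}(t)$ are linearly independent for every $t\in[a,b]$. (The paper's standing convention is that curves are differentiable as many times as needed.) $\det(v_1,\dots,v_n)$ is the determinant of the matrix of coordinates of $v_1,\dots,v_n$ in any positive orthonormal basis of $V$. For a strongly regular curve, the sign of $\det(c'(t),\dots,c^{(n)}(t))$ is independent of $t$; it is denoted $\mathrm{sgn}(c)\in\{1,-1\}$ and called the sign of the curve. An isometry of $V$ is a map of the form $v\mapsto Av+w$ with $A\in O(V)$, $w\in V$; it is orientation preserving if $A\in SO(V)$. *)

theory Defs
  imports "HOL-Analysis.Analysis" "Jordan_Normal_Form.Determinant"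
begin

hide_const (open) Matrix.scalar_prod Matrix.orthogonal Determinants.det
no_notation Matrix.scalar_prod (infix "\<bullet>" 70)
no_notation vec_nth (infixl "$" 90)

text \<open>
  A euclidean space of dimension \<open>n\<close> is modelled by a type of class \<^class>\<open>real_inner\<close> together
  with an ordered orthonormal basis \<open>e 0, \<dots>, e (n - 1)\<close>. The basis forces the dimension to be
  \<open>n\<close> and represents the orientation, namely the one for which it is positive. (The class
  \<^class>\<open>euclidean_space\<close> excludes dimension 0 and carries no orientation.)
\<close>

definition ordered_onb :: "nat \<Rightarrow> (nat \<Rightarrow> 'a::real_inner) \<Rightarrow> bool" where
  "ordered_onb n e \<longleftrightarrow>
     (\<forall>i<n. \<forall>j<n. e i \<bullet> e j = (if i = j then 1 else 0)) \<and> span (e ` {..<n}) = UNIV"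

definition det_wrt :: "nat \<Rightarrow> (nat \<Rightarrow> 'a::real_inner) \<Rightarrow> (nat \<Rightarrow> 'a) \<Rightarrow> real" where
  "det_wrt n e v = Determinant.det (mat n n (\<lambda>(i, j). v j \<bullet> e i))"

lemma ordered_onb_inner:
  fixes e :: "nat \<Rightarrow> 'a::real_inner"
  assumes "ordered_onb n e"
  shows "x \<bullet> y = (\<Sum>k<n. (x \<bullet> e k) * (e k \<bullet> y))"
proof -
  define z where "z = (\<Sum>k<n. (x \<bullet> e k) *\<^sub>R e k)"
  have orth: "e i \<bullet> e j = (if i = j then 1 else 0)" if "i < n" "j < n" for i j
    using assms that unfolding ordered_onb_def by blast
  have "(x - z) \<bullet> e j = 0" if "j < n" for j
  proof -
    have "z \<bullet> e j = (\<Sum>k<n. (x \<bullet> e k) * (if k = j then 1 else 0))"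
      unfolding z_def inner_sum_left using that by (intro sum.cong) (auto simp: orth)
    also have "\<dots> = x \<bullet> e j" using that by (simp add: if_distrib cong: if_cong)
    finally show ?thesis by (simp add: inner_diff_left)
  qed
  then have "orthogonal (x - z) w" if "w \<in> span (e ` {..<n})" for w
    using orthogonal_to_span[OF that, of "x - z"] by (auto simp: Linear_Algebra.orthogonal_def)
  then have "orthogonal (x - z) (x - z)"
    using assms unfolding ordered_onb_def by auto
  then have "x = z" by (simp add: Linear_Algebra.orthogonal_def)
  then have "x \<bullet> y = z \<bullet> y" by simp
  then show ?thesis by (simp add: z_def inner_sum_left)
qed

text \<open>The determinant is the same for all positive orthonormal bases.\<close>

lemma det_wrt_positive_onb:
  fixes e e' :: "nat \<Rightarrow> 'a::real_inner"
  assumes e: "ordered_onb n e" and e': "ordered_onb n e'" and pos: "det_wrt n e e' > 0"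
  shows "det_wrt n e' v = det_wrt n e v"
proof -
  define Q where "Q = mat n n (\<lambda>(i, j). e' j \<bullet> e i)"
  have Q[simp]: "Q \<in> carrier_mat n n" "transpose_mat Q \<in> carrier_mat n n"
    by (simp_all add: Q_def)
  have mult: "mat n n (\<lambda>(i, j). w j \<bullet> e' i) = transpose_mat Q * mat n n (\<lambda>(i, j). w j \<bullet> e i)"
    for w :: "nat \<Rightarrow> 'a"
  proof (rule eq_matI)
    fix i j
    assume "i < dim_row (transpose_mat Q * mat n n (\<lambda>(i, j). w j \<bullet> e i))"
      and "j < dim_col (transpose_mat Q * mat n n (\<lambda>(i, j). w j \<bullet> e i))"
    then have "i < n" "j < n" by (simp_all add: Q_def)
    then show "mat n n (\<lambda>(i, j). w j \<bullet> e' i) $$ (i, j)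
        = (transpose_mat Q * mat n n (\<lambda>(i, j). w j \<bullet> e i)) $$ (i, j)"
      using ordered_onb_inner[OF e, of "e' i" "w j"]
      by (simp add: Q_def Matrix.scalar_prod_def inner_commute lessThan_atLeast0)
  qed (simp_all add: Q_def)
  have det: "det_wrt n e' w = Determinant.det Q * det_wrt n e w" for w
    unfolding det_wrt_def mult
    by (subst det_mult[where n = n]) (auto simp: det_transpose[where n = n])
  have "mat n n (\<lambda>(i, j). e' j \<bullet> e' i) = 1\<^sub>m n"
    using e' by (intro eq_matI) (auto simp: ordered_onb_def)
  then have "det_wrt n e' e' = 1" by (simp add: det_wrt_def)
  moreover have "det_wrt n e e' = Determinant.det Q" by (simp add: det_wrt_def Q_def)
  ultimately have "(Determinant.det Q)\<^sup>2 = 1" "Determinant.det Q > 0"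
    using det[of e'] pos by (simp_all add: power2_eq_square)
  then have "Determinant.det Q = 1"
    by (simp add: power2_eq_1_iff)
  then show ?thesis using det by simp
qed

text \<open>Derivatives at the endpoints are one-sided.\<close>

definition curve_deriv ::
    "real \<Rightarrow> real \<Rightarrow> nat \<Rightarrow> (real \<Rightarrow> 'a::real_normed_vector) \<Rightarrow> real \<Rightarrow> 'a" where
  "curve_deriv a b k c = ((\<lambda>f t. vector_derivative f (at t within {a..b})) ^^ k) c"

definition n_times_continuously_differentiable ::
    "nat \<Rightarrow> real \<Rightarrow> real \<Rightarrow> (real \<Rightarrow> 'a::real_normed_vector) \<Rightarrow> bool" where
  "n_times_continuously_differentiable n a b c \<longleftrightarrow>
     (\<forall>k<n. curve_deriv a b k c differentiable_on {a..b}) \<and>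
     continuous_on {a..b} (curve_deriv a b n c)"

text \<open>Injectivity is needed since \<^const>\<open>independent\<close> speaks about sets, not families.\<close>

definition strongly_regular ::
    "nat \<Rightarrow> real \<Rightarrow> real \<Rightarrow> (real \<Rightarrow> 'a::real_normed_vector) \<Rightarrow> bool" where
  "strongly_regular n a b c \<longleftrightarrow>
     n_times_continuously_differentiable n a b c \<and>
     (\<forall>t\<in>{a..b}. inj_on (\<lambda>k. curve_deriv a b k c t) {1..n} \<and>
        independent ((\<lambda>k. curve_deriv a b k c t) ` {1..n}))"

definition curve_sgn ::
    "nat \<Rightarrow> (nat \<Rightarrow> 'a::real_inner) \<Rightarrow> real \<Rightarrow> real \<Rightarrow> (real \<Rightarrow> 'a) \<Rightarrow> real" where
  "curve_sgn n e a b c =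
     (THE s. \<forall>t\<in>{a..b}. sgn (det_wrt n e (\<lambda>k. curve_deriv a b (Suc k) c t)) = s)"

lemma continuous_on_curve_deriv:
  assumes "n_times_continuously_differentiable n a b c" and "k \<le> n"
  shows "continuous_on {a..b} (curve_deriv a b k c)"
  using assms unfolding n_times_continuously_differentiable_def
  by (cases "k = n") (auto intro: differentiable_imp_continuous_on)

lemma det_wrt_strongly_regular_nonzero:
  fixes c :: "real \<Rightarrow> 'a::real_inner"
  assumes e: "ordered_onb n e" and c: "strongly_regular n a b c" and t: "t \<in> {a..b}"
  shows "det_wrt n e (\<lambda>k. curve_deriv a b (Suc k) c t) \<noteq> 0"
proof
  define d where "d k = curve_deriv a b (Suc k) c t" for k
  define M where "M = mat n n (\<lambda>(i, j). d j \<bullet> e i)"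
  assume "det_wrt n e (\<lambda>k. curve_deriv a b (Suc k) c t) = 0"
  then have "Determinant.det M = 0" by (simp add: det_wrt_def M_def d_def)
  moreover have M: "M \<in> carrier_mat n n" by (simp add: M_def)
  ultimately obtain v where v: "v \<in> carrier_vec n" "v \<noteq> 0\<^sub>v n" "M *\<^sub>v v = 0\<^sub>v n"
    using det_0_iff_vec_prod_zero_field by blast
  define z where "z = (\<Sum>j<n. (v $ j) *\<^sub>R d j)"
  have "z \<bullet> e i = 0" if i: "i < n" for i
  proof -
    have "(M *\<^sub>v v) $ i = 0" using v i by simp
    then show ?thesis using i v M
      by (simp add: M_def z_def inner_sum_left Matrix.scalar_prod_def lessThan_atLeast0 mult.commute)
  qed
  then have "z \<bullet> z = 0" using ordered_onb_inner[OF e, of z z] by simp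
  then have z: "(\<Sum>j<n. (v $ j) *\<^sub>R d j) = 0" by (simp add: z_def)
  have img: "(\<lambda>k. curve_deriv a b k c t) ` {1..n} = d ` {..<n}"
    unfolding d_def image_Suc_lessThan[symmetric] image_image ..
  have "inj_on ((\<lambda>k. curve_deriv a b k c t) \<circ> Suc) {..<n}"
    using c t by (intro comp_inj_on) (auto simp: strongly_regular_def image_Suc_lessThan)
  then have inj: "inj_on d {..<n}" by (simp add: d_def[abs_def] comp_def)
  have "independent (d ` {..<n})"
    using c t unfolding strongly_regular_def img[symmetric] by blast
  moreover have inv: "the_inv_into {..<n} d (d j) = j" if "j < n" for j
    using that by (simp add: the_inv_into_f_f[OF inj])
  have "(\<Sum>x\<in>d ` {..<n}. (v $ the_inv_into {..<n} d x) *\<^sub>R x) = (\<Sum>j<n. (v $ j) *\<^sub>R d j)"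
    unfolding sum.reindex[OF inj] comp_def by (intro sum.cong refl) (simp add: inv)
  then have "(\<Sum>x\<in>d ` {..<n}. (v $ the_inv_into {..<n} d x) *\<^sub>R x) = 0"
    using z by simp
  ultimately have "v $ the_inv_into {..<n} d (d j) = 0" if "j < n" for j
    using that by (intro independentD[of "d ` {..<n}" "d ` {..<n}"]) auto
  then have "v $ j = 0" if "j < n" for j
    using that inv by simp
  then have "v = 0\<^sub>v n" using v(1) by (intro eq_vecI) auto
  with v(2) show False by simp
qed

text \<open>The sign is indeed independent of \<open>t\<close>.\<close>

lemma curve_sgn_eq:
  fixes c :: "real \<Rightarrow> 'a::real_inner"
  assumes e: "ordered_onb n e" and c: "strongly_regular n a b c" and t: "t \<in> {a..b}"
  shows "curve_sgn n e a b c = sgn (det_wrt n e (\<lambda>k. curve_deriv a b (Suc k) c t))"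
proof -
  define D where "D s = det_wrt n e (\<lambda>k. curve_deriv a b (Suc k) c s)" for s
  have nz: "D s \<noteq> 0" if "s \<in> {a..b}" for s
    using det_wrt_strongly_regular_nonzero[OF e c that] by (simp add: D_def)
  have "D s = (\<Sum>p | p permutes {0..<n}. signof p *
      (\<Prod>i = 0..<n. curve_deriv a b (Suc (p i)) c s \<bullet> e i))" for s
  proof -
    have "p i < n" if "p permutes {0..<n}" "i < n" for p i
      using that permutes_in_image[of p "{0..<n}" i] by simp
    then show ?thesis
      unfolding D_def det_wrt_def
      by (subst det_def'[where n = n]) (auto intro!: sum.cong prod.cong)
  qed
  moreover have "continuous_on {a..b} (\<lambda>s. \<Sum>p | p permutes {0..<n}. signof p *
      (\<Prod>i = 0..<n. curve_deriv a b (Suc (p i)) c s \<bullet> e i) :: real)"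
  proof (intro continuous_on_sum continuous_on_mult continuous_on_prod continuous_on_inner
      continuous_on_const)
    fix p i
    assume "p \<in> {p. p permutes {0..<n}}" "i \<in> {0..<n}"
    then have "Suc (p i) \<le> n"
      using permutes_in_image[of p "{0..<n}" i] by (simp add: Suc_le_eq)
    then show "continuous_on {a..b} (curve_deriv a b (Suc (p i)) c)"
      using c by (auto simp: strongly_regular_def intro: continuous_on_curve_deriv)
  qed
  ultimately have "continuous_on {a..b} D" by presburger
  then have conn: "connected (D ` {a..b})" by (intro connected_continuous_image) auto
  have sgn_eq: "sgn (D s) = sgn (D t)" if "s \<in> {a..b}" for s
  proof (rule ccontr)
    assume "sgn (D s) \<noteq> sgn (D t)"
    then have "D s < 0 \<and> 0 < D t \<or> D t < 0 \<and> 0 < D s"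
      using nz[OF that] nz[OF t] by (auto simp: sgn_if split: if_splits)
    then have "0 \<in> D ` {a..b}"
      using connectedD_interval[OF conn, of "D s" "D t" 0]
        connectedD_interval[OF conn, of "D t" "D s" 0] that t by auto
    then show False using nz by auto
  qed
  then show ?thesis
    unfolding curve_sgn_def D_def[symmetric] using t by (intro the_equality) metis+
qed

definition euclidean_isometry :: "('a::real_inner \<Rightarrow> 'a) \<Rightarrow> bool" where
  "euclidean_isometry g \<longleftrightarrow> (\<exists>A w. orthogonal_transformation A \<and> g = (\<lambda>v. A v + w))"

text \<open>\<open>det_wrt n e (A \<circ> e)\<close> is the determinant of the linear map \<open>A\<close>.\<close>

definition orientation_preserving_isometry ::
    "nat \<Rightarrow> (nat \<Rightarrow> 'a::real_inner) \<Rightarrow> ('a \<Rightarrow> 'a) \<Rightarrow> bool" where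
  "orientation_preserving_isometry n e g \<longleftrightarrow>
     (\<exists>A w. orthogonal_transformation A \<and> det_wrt n e (A \<circ> e) = 1 \<and> g = (\<lambda>v. A v + w))"

end

theory Submission
  imports Defs
begin

text \<open>
  Differentiating the inner products of \<open>c\<^sup>(\<^sup>i\<^sup>)\<close> and \<open>c\<^sup>(\<^sup>j\<^sup>)\<close> shows that the norms determine the
  whole Gram matrix of \<open>c\<^sup>(\<^sup>1\<^sup>), \<dots>, c\<^sup>(\<^sup>n\<^sup>)\<close>, so at each \<open>t\<close> there is an orthogonal map \<open>A t\<close> taking
  these vectors to those of the other curve. The map \<open>t \<mapsto> A t\<close> is constant: for \<open>k < n\<close>,
  differentiating \<open>A t c\<^sup>(\<^sup>k\<^sup>)(t)\<close> shows that \<open>A'\<close> kills \<open>c\<^sup>(\<^sup>k\<^sup>)\<close>, and since \<open>A\<^sup>-\<^sup>1 A'\<close> is skew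
  and vanishes on a hyperplane, it is zero. As \<open>c\<^sup>(\<^sup>n\<^sup>)\<close> is merely continuous, the argument works with
  difference quotients, the differentiability of \<open>A\<close> being part of the conclusion.
\<close>

section \<open>Difference quotients and one-sided derivatives\<close>

text \<open>Allows differentiability of \<open>A\<close> to be concluded from a limit, where no
  differentiation rule applies.\<close>

lemma has_vector_derivative_iff_difference_quotient:
  fixes f :: "real \<Rightarrow> 'a::real_normed_vector"
  shows "(f has_vector_derivative f') (at s within S) \<longleftrightarrow>
    ((\<lambda>t. (f t - f s) /\<^sub>R (t - s)) \<longlongrightarrow> f') (at s within S)"
proof -
  have "norm ((f t - f s) /\<^sub>R (t - s) - f') = norm (f t - f s - (t - s) *\<^sub>R f') / norm (t - s)"
    if "t \<noteq> s" for t
  proof -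
    have "(f t - f s) /\<^sub>R (t - s) - f' = (f t - f s - (t - s) *\<^sub>R f') /\<^sub>R (t - s)"
      using that by (simp add: scaleR_diff_right)
    then show ?thesis by (simp add: divide_inverse mult.commute)
  qed
  then have "((\<lambda>t. norm (f t - f s - (t - s) *\<^sub>R f') / norm (t - s)) \<longlongrightarrow> 0) (at s within S) \<longleftrightarrow>
      ((\<lambda>t. norm ((f t - f s) /\<^sub>R (t - s) - f')) \<longlongrightarrow> 0) (at s within S)"
    by (intro Lim_cong_within) auto
  also have "\<dots> \<longleftrightarrow> ((\<lambda>t. (f t - f s) /\<^sub>R (t - s)) \<longlongrightarrow> f') (at s within S)"
    by (simp only: tendsto_norm_zero_iff LIM_zero_iff)
  finally show ?thesis
    unfolding has_vector_derivative_def has_derivative_iff_norm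
    by (simp add: bounded_linear_scaleR_left)
qed

text \<open>With \<open>a < b\<close> every point of the interval is a limit point of it; for
  \<open>a = b\<close> the filter would be trivial and every vector a derivative.\<close>

lemma has_vector_derivative_within_unique:
  fixes f :: "real \<Rightarrow> 'a::real_normed_vector"
  assumes "a < b" "t \<in> {a..b}"
    and "(f has_vector_derivative x) (at t within {a..b})"
    and "(f has_vector_derivative y) (at t within {a..b})"
  shows "x = y"
  using vector_derivative_within_cbox[of a b t f] assms by (metis box_real(2))

section \<open>Orthonormal expansion and dimension count\<close>

lemma ordered_onb_expansion:
  assumes "ordered_onb n e"
  shows "x = (\<Sum>k<n. (x \<bullet> e k) *\<^sub>R e k)"
proof -
  have "(x - (\<Sum>k<n. (x \<bullet> e k) *\<^sub>R e k)) \<bullet> y = 0" for y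
    by (simp add: inner_diff_left inner_sum_left ordered_onb_inner[OF assms, of x y])
  from this[of "x - (\<Sum>k<n. (x \<bullet> e k) *\<^sub>R e k)"] show ?thesis by simp
qed

text \<open>A vector outside the span would extend \<open>B\<close> to \<open>n + 1\<close>
  independent vectors in the span of the at most \<open>n\<close> vectors \<open>e i\<close>,
  against the exchange bound.\<close>

lemma span_eq_UNIV_if_card_eq:
  fixes e :: "nat \<Rightarrow> 'a::real_inner" and B :: "'a set"
  assumes e: "ordered_onb n e" and B: "independent B" "card B = n" "finite B"
  shows "span B = UNIV"
proof (rule ccontr)
  assume "span B \<noteq> UNIV"
  then obtain x where "x \<notin> span B" by auto
  then have "independent (insert x B)" "x \<notin> B"
    using B by (auto simp: independent_insert span_base)
  moreover have "insert x B \<subseteq> span (e ` {..<n})"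
    using e by (auto simp: ordered_onb_def)
  ultimately have "card (insert x B) \<le> card (e ` {..<n})"
    using independent_span_bound[of "e ` {..<n}" "insert x B"] by blast
  also have "\<dots> \<le> n" using card_image_le[of "{..<n}" e] by simp
  finally show False using B \<open>x \<notin> B\<close> by simp
qed

section \<open>The norms determine the Gram matrix\<close>

text \<open>Induction on the distance \<open>d\<close> of the two indices, with the norms as the
  case \<open>d = 0\<close>. Differentiating the product of \<open>V i\<close> and
  \<open>V (i + d - 1)\<close> gives the product wanted plus one of distance \<open>d - 2\<close>.
  No derivative beyond \<open>V (n - 1)\<close> enters.\<close>

lemma gram_determined_by_norms:
  fixes V W :: "nat \<Rightarrow> real \<Rightarrow> 'a::real_inner"
  assumes "a < b"
    and V: "\<And>k t. Suc k < n \<Longrightarrow> t \<in> {a..b} \<Longrightarrow>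
      (V k has_vector_derivative V (Suc k) t) (at t within {a..b})"
    and W: "\<And>k t. Suc k < n \<Longrightarrow> t \<in> {a..b} \<Longrightarrow>
      (W k has_vector_derivative W (Suc k) t) (at t within {a..b})"
    and norms: "\<And>k t. k < n \<Longrightarrow> t \<in> {a..b} \<Longrightarrow> norm (W k t) = norm (V k t)"
    and "i < n" "j < n" "t \<in> {a..b}"
  shows "W i t \<bullet> W j t = V i t \<bullet> V j t"
proof -
  have gram: "W i t \<bullet> W (i + d) t = V i t \<bullet> V (i + d) t" if "i + d < n" "t \<in> {a..b}" for i d t
    using that
  proof (induction d arbitrary: i t rule: less_induct)
    case (less d)
    show ?case
    proof (cases d)
      case 0
      then show ?thesis
        using norms[of i t] less.prems by (simp add: dot_square_norm)
    next
      case (Suc m)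
      let ?D = "at t within {a..b}"
      have eq: "W i s \<bullet> W (i + m) s = V i s \<bullet> V (i + m) s" if "s \<in> {a..b}" for s
        using less.IH[of m i s] less.prems Suc that by simp
      have dV: "((\<lambda>s. V i s \<bullet> V (i + m) s) has_vector_derivative
          V i t \<bullet> V (i + d) t + V (Suc i) t \<bullet> V (i + m) t) ?D"
        using bounded_bilinear.has_vector_derivative[OF bounded_bilinear_inner
            V[of i t] V[of "i + m" t]] less.prems Suc by simp
      have "((\<lambda>s. W i s \<bullet> W (i + m) s) has_vector_derivative
          W i t \<bullet> W (i + d) t + W (Suc i) t \<bullet> W (i + m) t) ?D"
        using bounded_bilinear.has_vector_derivative[OF bounded_bilinear_inner
            W[of i t] W[of "i + m" t]] less.prems Suc by simp
      then have "((\<lambda>s. V i s \<bullet> V (i + m) s) has_vector_derivative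
          W i t \<bullet> W (i + d) t + W (Suc i) t \<bullet> W (i + m) t) ?D"
        by (rule has_vector_derivative_transform[rotated 2]) (use less.prems eq in auto)
      then have sum: "W i t \<bullet> W (i + d) t + W (Suc i) t \<bullet> W (i + m) t =
          V i t \<bullet> V (i + d) t + V (Suc i) t \<bullet> V (i + m) t"
        using has_vector_derivative_within_unique[OF \<open>a < b\<close> _ _ dV] less.prems by blast
      show ?thesis
      \<comment> \<open>For \<open>d = 1\<close> the two summands of \<open>sum\<close> coincide by
        symmetry; otherwise the second one starts at \<open>Suc i\<close> with distance
        \<open>d - 2\<close> and cancels by induction.\<close>
      proof (cases m)
        case 0
        then show ?thesis using sum Suc by (simp add: inner_commute)
      next
        case (Suc l)
        then show ?thesis
          using sum less.IH[of l "Suc i" t] less.prems \<open>d = Suc m\<close> by simp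
      qed
    qed
  qed
  show ?thesis
    using gram[of i "j - i" t] gram[of j "i - j" t] assms(5-)
    by (cases "i \<le> j") (auto simp: inner_commute)
qed

section \<open>Orthogonal maps between families with equal Gram matrices\<close>

text \<open>The linear extension of \<open>v i\<close> to \<open>w i\<close> preserves inner
  products of basis vectors; linearity, used in one argument at a time, carries this over to all
  vectors.\<close>

lemma orthogonal_transformation_of_gram_eq:
  fixes v w :: "nat \<Rightarrow> 'a::real_inner"
  assumes inj: "inj_on v I" and indep: "independent (v ` I)" and span: "span (v ` I) = UNIV"
    and gram: "\<And>i j. i \<in> I \<Longrightarrow> j \<in> I \<Longrightarrow> w i \<bullet> w j = v i \<bullet> v j"
  obtains A where "orthogonal_transformation A" "\<And>i. i \<in> I \<Longrightarrow> A (v i) = w i"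
proof -
  obtain A where A: "linear A" and "\<forall>x\<in>v ` I. A x = w (the_inv_into I v x)"
    using linear_independent_extend[OF indep, of "w \<circ> the_inv_into I v"] by auto
  then have Av: "A (v i) = w i" if "i \<in> I" for i
    using that inj by (simp add: the_inv_into_f_f)
  have "A x \<bullet> A y = x \<bullet> y" for x y
  proof -
    have step: "A x \<bullet> A (v j) = x \<bullet> v j" if "j \<in> I" for x j
    proof -
      have "x \<in> span (v ` I)" using span by simp
      then show ?thesis
      proof (induction rule: span_induct)
        show "subspace {x. A x \<bullet> A (v j) = x \<bullet> v j}"
          using A by (auto simp: subspace_def linear_0 linear_add linear_cmul inner_add_left)
      qed (use that Av gram in auto)
    qed
    have "y \<in> span (v ` I)" using span by simp
    then show ?thesis
    proof (induction rule: span_induct)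
      show "subspace {y. A x \<bullet> A y = x \<bullet> y}"
        using A by (auto simp: subspace_def linear_0 linear_add linear_cmul inner_add_right)
    qed (use step in auto)
  qed
  with A Av show thesis using that by (auto simp: orthogonal_transformation_def)
qed

section \<open>Limits under orthogonal maps and limits tested by inner products\<close>

lemma bounded_linear_orthogonal_transformation:
  "orthogonal_transformation A \<Longrightarrow> bounded_linear A"
  by (rule bounded_linear_intro[where K = 1])
    (auto simp: orthogonal_transformation linear_add linear_cmul)

text \<open>Norm preservation makes the maps \<open>A t\<close> equicontinuous:
  \<open>A t (f t)\<close> and \<open>A t y\<close> are exactly as far apart as \<open>f t\<close>
  and \<open>y\<close>.\<close>

lemma tendsto_orthogonal_transformation:
  fixes A :: "'b \<Rightarrow> 'a::real_inner \<Rightarrow> 'a"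
  assumes orth: "eventually (\<lambda>t. orthogonal_transformation (A t)) F"
    and A: "((\<lambda>t. A t y) \<longlongrightarrow> z) F" and f: "(f \<longlongrightarrow> y) F"
  shows "((\<lambda>t. A t (f t)) \<longlongrightarrow> z) F"
proof -
  have "((\<lambda>t. norm (f t - y)) \<longlongrightarrow> 0) F"
    using f by (simp add: LIM_zero tendsto_norm_zero)
  moreover have "eventually (\<lambda>t. norm (f t - y) = norm (A t (f t) - A t y)) F"
    using orth by eventually_elim (metis linear_diff orthogonal_transformation)
  ultimately have "((\<lambda>t. norm (A t (f t) - A t y)) \<longlongrightarrow> 0) F"
    by (rule Lim_transform_eventually)
  then have "((\<lambda>t. (A t (f t) - A t y) + A t y) \<longlongrightarrow> 0 + z) F"
    using A by (intro tendsto_add) (auto simp: tendsto_norm_zero_iff)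
  then show ?thesis by simp
qed

text \<open>The vectors \<open>y\<close> whose inner product with \<open>z\<close> tends to 0 form a
  subspace. It contains \<open>B\<close>, hence every \<open>e k\<close>, and so all coordinates of
  \<open>z\<close> tend to 0.\<close>

lemma tendsto_zero_if_inner_spanning:
  fixes z :: "'b \<Rightarrow> 'a::real_inner"
    and e :: "nat \<Rightarrow> 'a"
  assumes e: "ordered_onb n e" and span: "span B = UNIV"
    and B: "\<And>y. y \<in> B \<Longrightarrow> ((\<lambda>t. y \<bullet> z t) \<longlongrightarrow> 0) F"
  shows "(z \<longlongrightarrow> 0) F"
proof -
  have "((\<lambda>t. z t \<bullet> y) \<longlongrightarrow> 0) F" for y
  proof -
    have "y \<in> span B" using span by simp
    then have "((\<lambda>t. y \<bullet> z t) \<longlongrightarrow> 0) F"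
    proof (induction rule: span_induct)
      show "subspace {y. ((\<lambda>t. y \<bullet> z t) \<longlongrightarrow> 0) F}"
        by (auto simp: subspace_def inner_add_left intro: tendsto_add_zero tendsto_mult_right_zero)
    qed (use B in auto)
    then show ?thesis by (simp add: inner_commute)
  qed
  then have "((\<lambda>t. \<Sum>k<n. (z t \<bullet> e k) *\<^sub>R e k) \<longlongrightarrow> (\<Sum>k<n. 0 *\<^sub>R e k)) F"
    by (intro tendsto_intros)
  then show ?thesis using ordered_onb_expansion[OF e] by simp
qed

section \<open>Constancy of the moving isometry\<close>

lemma moving_isometry_constant:
  fixes V W :: "nat \<Rightarrow> real \<Rightarrow> 'a::real_inner" and A :: "real \<Rightarrow> 'a \<Rightarrow> 'a"
    and e :: "nat \<Rightarrow> 'a"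
  assumes e: "ordered_onb n e"
    and V: "\<And>k t. Suc k < n \<Longrightarrow> t \<in> {a..b} \<Longrightarrow>
      (V k has_vector_derivative V (Suc k) t) (at t within {a..b})"
    and W: "\<And>k t. Suc k < n \<Longrightarrow> t \<in> {a..b} \<Longrightarrow>
      (W k has_vector_derivative W (Suc k) t) (at t within {a..b})"
    and contV: "\<And>k. k < n \<Longrightarrow> continuous_on {a..b} (V k)"
    and contW: "\<And>k. k < n \<Longrightarrow> continuous_on {a..b} (W k)"
    and spanV: "\<And>t. t \<in> {a..b} \<Longrightarrow> span ((\<lambda>k. V k t) ` {..<n}) = UNIV"
    and spanW: "\<And>t. t \<in> {a..b} \<Longrightarrow> span ((\<lambda>k. W k t) ` {..<n}) = UNIV"
    and A: "\<And>t. t \<in> {a..b} \<Longrightarrow> orthogonal_transformation (A t)"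
    and AV: "\<And>k t. k < n \<Longrightarrow> t \<in> {a..b} \<Longrightarrow> A t (V k t) = W k t"
  obtains A0 where "\<And>t. t \<in> {a..b} \<Longrightarrow> A t = A0"
proof -
  have deriv: "((\<lambda>t. A t x) has_vector_derivative 0) (at s within {a..b})"
    if s: "s \<in> {a..b}" for s x
  proof -
    let ?F = "at s within {a..b}"
    have ev: "eventually (\<lambda>t. t \<in> {a..b} \<and> t \<noteq> s) ?F"
      by (simp add: eventually_at_filter)
    then have orth: "eventually (\<lambda>t. orthogonal_transformation (A t)) ?F"
      by eventually_elim (simp add: A)
    have linA: "linear (A t)" if "t \<in> {a..b}" for t
      using A[OF that] by (simp add: orthogonal_transformation_def)
    \<comment> \<open>The frame is taken at the fixed time \<open>s\<close>, while the maps
      \<open>A t\<close> applied to it vary.\<close>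
    have span_all: "P x" if "subspace {x. P x}" "\<And>k. k < n \<Longrightarrow> P (V k s)" for P x
    proof -
      have "x \<in> span ((\<lambda>k. V k s) ` {..<n})" using spanV[OF s] by simp
      then show ?thesis by (induction rule: span_induct) (use that in auto)
    qed
    have Atendsto: "((\<lambda>t. A t x) \<longlongrightarrow> A s x) ?F" for x
    proof (rule span_all[where P = "\<lambda>x. ((\<lambda>t. A t x) \<longlongrightarrow> A s x) ?F" and x = x])
      show "subspace {x. ((\<lambda>t. A t x) \<longlongrightarrow> A s x) ?F}"
      proof (rule subspaceI; unfold mem_Collect_eq)
        have "eventually (\<lambda>t. 0 = A t 0) ?F"
          using ev by eventually_elim (simp add: linA linear_0)
        then show "((\<lambda>t. A t 0) \<longlongrightarrow> A s 0) ?F"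
          using linear_0[OF linA[OF s]] by (auto intro: Lim_transform_eventually[OF tendsto_const])
      next
        fix x y
        assume "((\<lambda>t. A t x) \<longlongrightarrow> A s x) ?F" "((\<lambda>t. A t y) \<longlongrightarrow> A s y) ?F"
        then have "((\<lambda>t. A t x + A t y) \<longlongrightarrow> A s (x + y)) ?F"
          by (simp add: linear_add[OF linA[OF s]] tendsto_add)
        moreover have "eventually (\<lambda>t. A t x + A t y = A t (x + y)) ?F"
          using ev by eventually_elim (simp add: linA linear_add)
        ultimately show "((\<lambda>t. A t (x + y)) \<longlongrightarrow> A s (x + y)) ?F"
          by (rule Lim_transform_eventually)
      next
        fix c x
        assume "((\<lambda>t. A t x) \<longlongrightarrow> A s x) ?F"
        then have "((\<lambda>t. c *\<^sub>R A t x) \<longlongrightarrow> A s (c *\<^sub>R x)) ?F"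
          by (simp add: linear_cmul[OF linA[OF s]] tendsto_scaleR)
        moreover have "eventually (\<lambda>t. c *\<^sub>R A t x = A t (c *\<^sub>R x)) ?F"
          using ev by eventually_elim (simp add: linA linear_cmul)
        ultimately show "((\<lambda>t. A t (c *\<^sub>R x)) \<longlongrightarrow> A s (c *\<^sub>R x)) ?F"
          by (rule Lim_transform_eventually)
      qed
    next
      fix k assume k: "k < n"
      have lim: "((\<lambda>t. V k t) \<longlongrightarrow> V k s) ?F" "((\<lambda>t. W k t) \<longlongrightarrow> W k s) ?F"
        using contV[OF k] contW[OF k] s by (auto simp: continuous_on_def)
      have "((\<lambda>t. norm (V k s - V k t)) \<longlongrightarrow> 0) ?F"
        using tendsto_norm[OF tendsto_diff[OF tendsto_const lim(1)], of "V k s"] by simp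
      \<comment> \<open>Since \<open>W k t = A t (V k t)\<close>, the right-hand vector is the image
        of the left-hand one under \<open>A t\<close>.\<close>
      moreover have "eventually (\<lambda>t. norm (V k s - V k t) = norm (A t (V k s) - W k t)) ?F"
        using ev by eventually_elim (metis A AV k linear_diff orthogonal_transformation)
      ultimately have "((\<lambda>t. norm (A t (V k s) - W k t)) \<longlongrightarrow> 0) ?F"
        by (rule Lim_transform_eventually)
      then have "((\<lambda>t. (A t (V k s) - W k t) + W k t) \<longlongrightarrow> 0 + W k s) ?F"
        using lim by (intro tendsto_add) (auto simp: tendsto_norm_zero_iff)
      then show "((\<lambda>t. A t (V k s)) \<longlongrightarrow> A s (V k s)) ?F"
        using AV[OF k s] by simp
    qed
    define D where "D x t = (A t x - A s x) /\<^sub>R (t - s)" for x t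
    \<comment> \<open>A discrete product rule: the quotient \<open>r\<close> of \<open>W k\<close>
      is \<open>A t\<close> of the quotient \<open>q\<close> of \<open>V k\<close> plus
      \<open>D (V k s)\<close>. In the limit the first two terms agree, because \<open>A s\<close>
      maps \<open>V (Suc k) s\<close> to \<open>W (Suc k) s\<close>.\<close>
    have low: "(D (V k s) \<longlongrightarrow> 0) ?F" if k: "Suc k < n" for k
    proof -
      define q where "q t = (V k t - V k s) /\<^sub>R (t - s)" for t
      define r where "r t = (W k t - W k s) /\<^sub>R (t - s)" for t
      have q: "(q \<longlongrightarrow> V (Suc k) s) ?F" and r: "(r \<longlongrightarrow> W (Suc k) s) ?F"
        using V[OF k s] W[OF k s] unfolding q_def r_def
        by (simp_all add: has_vector_derivative_iff_difference_quotient)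
      have "((\<lambda>t. r t - A t (q t)) \<longlongrightarrow> W (Suc k) s - A s (V (Suc k) s)) ?F"
        by (rule tendsto_diff[OF r tendsto_orthogonal_transformation[OF orth Atendsto q]])
      then have "((\<lambda>t. r t - A t (q t)) \<longlongrightarrow> 0) ?F"
        using AV[OF k s] by simp
      moreover have "eventually (\<lambda>t. r t - A t (q t) = D (V k s) t) ?F"
        using ev
      proof eventually_elim
        case (elim t)
          have "A t (q t) = (W k t - A t (V k s)) /\<^sub>R (t - s)"
            using AV[of k t] k elim linA[of t] by (simp add: q_def linear_cmul linear_diff)
          moreover have "A s (V k s) = W k s" using AV k s by simp
          ultimately show ?case by (simp add: r_def D_def flip: scaleR_diff_right)
      qed
      ultimately show ?thesis by (rule Lim_transform_eventually)
    qed
    \<comment> \<open>The vector \<open>V m\<close> is the highest derivative and has no quotient to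
      compare with. Instead, \<open>D ?x\<close> is tested against the frame
      \<open>A s (V k s)\<close>.\<close>
    have top: "(D (V m s) \<longlongrightarrow> 0) ?F" if m: "n = Suc m" for m
    proof -
      let ?x = "V m s"
      \<comment> \<open>Dividing by \<open>1 + norm\<close> lets the argument run before \<open>D ?x\<close> is known to be bounded.\<close>
      define q where "q t = D ?x t /\<^sub>R (1 + norm (D ?x t))" for t
      have bounded: "norm (inverse (1 + norm z)) \<le> 1" for z :: 'a
        by (simp add: divide_le_eq_1 inverse_eq_divide add_pos_nonneg)
      have inv0: "((\<lambda>t. inverse (1 + norm (D ?x t)) * f t) \<longlongrightarrow> 0) ?F" if "(f \<longlongrightarrow> 0) ?F"
        for f :: "real \<Rightarrow> real"
      proof (rule Lim_null_comparison[OF _ tendsto_rabs_zero[OF that]])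
        have "\<bar>inverse (1 + norm (D ?x t)) * f t\<bar> \<le> \<bar>f t\<bar>" for t
          using mult_right_mono[OF bounded[of "D ?x t"], of "\<bar>f t\<bar>"] by (simp add: abs_mult)
        then show "eventually (\<lambda>t. norm (inverse (1 + norm (D ?x t)) * f t) \<le> \<bar>f t\<bar>) ?F" by simp
      qed
      have "(q \<longlongrightarrow> 0) ?F"
      proof (rule tendsto_zero_if_inner_spanning[OF e])
        show "span ((\<lambda>k. W k s) ` {..<n}) = UNIV" by (rule spanW[OF s])
      next
        fix y assume "y \<in> (\<lambda>k. W k s) ` {..<n}"
        then obtain k where k: "k < n" "y = A s (V k s)" using AV s by auto
        show "((\<lambda>t. y \<bullet> q t) \<longlongrightarrow> 0) ?F"
        proof (cases "k = m")
          \<comment> \<open>Discrete skewness: as \<open>A t\<close> and \<open>A s\<close> both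
            preserve the product of \<open>V k s\<close> and \<open>?x\<close>, the difference
            quotient moves from \<open>?x\<close> to \<open>V k s\<close> with a change of sign, and
            there \<open>low\<close> applies.\<close>
          case False
          then have "(D (V k s) \<longlongrightarrow> 0) ?F" using k m by (intro low) simp
          then have "((\<lambda>t. - (D (V k s) t \<bullet> A t ?x)) \<longlongrightarrow> - (0 \<bullet> A s ?x)) ?F"
            by (intro tendsto_intros Atendsto)
          then have "((\<lambda>t. inverse (1 + norm (D ?x t)) * - (D (V k s) t \<bullet> A t ?x)) \<longlongrightarrow> 0) ?F"
            by (intro inv0) simp
          moreover have "eventually (\<lambda>t. inverse (1 + norm (D ?x t)) * - (D (V k s) t \<bullet> A t ?x)
              = y \<bullet> q t) ?F"
            using ev
          proof eventually_elim
            case (elim t)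
            then have "A t (V k s) \<bullet> A t ?x = A s (V k s) \<bullet> A s ?x"
              using A s by (simp add: orthogonal_transformation_def)
            then have "- (D (V k s) t \<bullet> A t ?x) = y \<bullet> D ?x t"
              by (simp add: D_def k inner_diff_left inner_diff_right right_diff_distrib)
            then show ?case by (simp add: q_def)
          qed
          ultimately show ?thesis by (rule Lim_transform_eventually)
        next
          case True
          \<comment> \<open>Here \<open>y = A s ?x\<close>. Equal norms of \<open>A t ?x\<close> and
            \<open>A s ?x\<close> make the product of \<open>y\<close> and their difference
            quadratic in that difference; after division by \<open>t - s\<close> one factor still
            tends to 0 by continuity, and the other is absorbed by the normalisation in
            \<open>q\<close>.\<close>
          have "((\<lambda>t. norm (A t ?x - A s ?x)) \<longlongrightarrow> 0) ?F"
            using Atendsto by (simp add: LIM_zero tendsto_norm_zero)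
          moreover have "eventually (\<lambda>t. norm (y \<bullet> q t) \<le> norm (A t ?x - A s ?x)) ?F"
            using ev
          proof eventually_elim
            case (elim t)
            let ?d = "A t ?x - A s ?x"
            have "A t ?x \<bullet> A t ?x = A s ?x \<bullet> A s ?x"
              using A s elim by (simp add: orthogonal_transformation_def)
            then have "2 * (y \<bullet> ?d) = - (?d \<bullet> ?d)"
              using k True by (simp add: inner_diff_left inner_diff_right inner_commute)
            then have "2 * (y \<bullet> D ?x t) = - (?d \<bullet> D ?x t)"
              by (simp add: D_def mult.left_commute[of 2])
            then have "2 * \<bar>y \<bullet> D ?x t\<bar> = \<bar>?d \<bullet> D ?x t\<bar>" by linarith
            also have "\<dots> \<le> norm ?d * norm (D ?x t)" by (rule Cauchy_Schwarz_ineq2)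
            also have "\<dots> \<le> norm ?d * (1 + norm (D ?x t))" by (intro mult_left_mono) auto
            finally have "\<bar>y \<bullet> D ?x t\<bar> \<le> norm ?d * (1 + norm (D ?x t))" by linarith
            moreover have "1 + norm (D ?x t) > 0" by (smt (verit) norm_ge_zero)
            ultimately show ?case
              by (simp add: q_def abs_mult divide_simps)
          qed
          ultimately show ?thesis by (rule Lim_null_comparison[rotated])
        qed
      qed
      \<comment> \<open>Undoes the normalisation: u / (1 - u) is the inverse of u / (1 + u), and it
        is continuous at 0.\<close>
      then have "((\<lambda>t. norm (q t) / (1 - norm (q t))) \<longlongrightarrow> norm (0::'a) / (1 - norm (0::'a))) ?F"
        by (intro tendsto_intros) auto
      moreover have "norm (q t) / (1 - norm (q t)) = norm (D ?x t)" for t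
      proof -
        have p: "1 + norm (D ?x t) > 0" by (smt (verit) norm_ge_zero)
        then have "norm (q t) = norm (D ?x t) / (1 + norm (D ?x t))"
          by (simp add: q_def divide_inverse)
        moreover from p have "1 - norm (D ?x t) / (1 + norm (D ?x t)) = 1 / (1 + norm (D ?x t))"
          by (simp add: diff_divide_eq_iff)
        ultimately show ?thesis using p by simp
      qed
      ultimately show ?thesis by (simp add: tendsto_norm_zero_iff)
    qed
    show ?thesis
      unfolding has_vector_derivative_iff_difference_quotient D_def[symmetric]
    proof (rule span_all[where P = "\<lambda>x. (D x \<longlongrightarrow> 0) ?F" and x = x])
      show "subspace {x. (D x \<longlongrightarrow> 0) ?F}"
      proof (rule subspaceI; unfold mem_Collect_eq)
        have "eventually (\<lambda>t. 0 = D 0 t) ?F"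
          using ev by eventually_elim (simp add: D_def linA linear_0 linA[OF s])
        then show "(D 0 \<longlongrightarrow> 0) ?F"
          by (rule Lim_transform_eventually[OF tendsto_const])
      next
        fix x y
        assume "(D x \<longlongrightarrow> 0) ?F" "(D y \<longlongrightarrow> 0) ?F"
        then have "((\<lambda>t. D x t + D y t) \<longlongrightarrow> 0) ?F" by (rule tendsto_add_zero)
        moreover have "eventually (\<lambda>t. D x t + D y t = D (x + y) t) ?F"
          using ev by eventually_elim (simp add: D_def linA linear_add linA[OF s] algebra_simps)
        ultimately show "(D (x + y) \<longlongrightarrow> 0) ?F"
          by (rule Lim_transform_eventually)
      next
        fix c x
        assume "(D x \<longlongrightarrow> 0) ?F"
        from tendsto_scaleR[OF tendsto_const this]
        have "((\<lambda>t. c *\<^sub>R D x t) \<longlongrightarrow> 0) ?F" by simp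
        moreover have "eventually (\<lambda>t. c *\<^sub>R D x t = D (c *\<^sub>R x) t) ?F"
          using ev by eventually_elim
            (simp add: D_def linA linear_cmul linA[OF s] algebra_simps)
        ultimately show "(D (c *\<^sub>R x) \<longlongrightarrow> 0) ?F"
          by (rule Lim_transform_eventually)
      qed
    next
      fix k assume "k < n"
      then show "(D (V k s) \<longlongrightarrow> 0) ?F"
        using low[of k] top[of k] by (cases "Suc k < n") auto
    qed
  qed
  show thesis
  proof (cases "{a..b} = {}")
    case True
    then show thesis using that by blast
  next
    case False
    then obtain s where s: "s \<in> {a..b}" by blast
    have "A t = A s" if "t \<in> {a..b}" for t
    proof
      fix x
      obtain c where "\<And>t. t \<in> {a..b} \<Longrightarrow> A t x = c"
        using has_vector_derivative_zero_constant[OF _ deriv] by (metis convex_real_interval(5))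
      then show "A t x = A s x" using that s by metis
    qed
    then show thesis by (rule that)
  qed
qed

section \<open>Determinants of linear and orthogonal maps\<close>

text \<open>In the basis \<open>e\<close>, the coordinate matrix of the image family is the matrix
  of \<open>A\<close> times the coordinate matrix of \<open>v\<close>.\<close>

lemma det_wrt_linear:
  fixes e :: "nat \<Rightarrow> 'a::real_inner"
  assumes e: "ordered_onb n e" and A: "linear A"
  shows "det_wrt n e (A \<circ> v) = det_wrt n e (A \<circ> e) * det_wrt n e v"
proof -
  let ?P = "mat n n (\<lambda>(i, j). A (e j) \<bullet> e i)" and ?M = "mat n n (\<lambda>(i, j). v j \<bullet> e i)"
  have "mat n n (\<lambda>(i, j). A (v j) \<bullet> e i) = ?P * ?M"
  proof (rule eq_matI)
    fix i j
    assume "i < dim_row (?P * ?M)" "j < dim_col (?P * ?M)"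
    then have ij: "i < n" "j < n" by simp_all
    have "A (v j) = A (\<Sum>k<n. (v j \<bullet> e k) *\<^sub>R e k)"
      using ordered_onb_expansion[OF e] by simp
    also have "\<dots> = (\<Sum>k<n. (v j \<bullet> e k) *\<^sub>R A (e k))"
      by (simp add: linear_sum[OF A] linear_cmul[OF A])
    finally show "mat n n (\<lambda>(i, j). A (v j) \<bullet> e i) $$ (i, j) = (?P * ?M) $$ (i, j)"
      using ij by (simp add: Matrix.scalar_prod_def inner_sum_left lessThan_atLeast0 mult.commute)
  qed simp_all
  then show ?thesis
    unfolding det_wrt_def comp_def by (simp add: det_mult[where n = n])
qed

text \<open>In an orthonormal basis the transpose of the matrix of \<open>A\<close> is its
  inverse.\<close>

lemma det_wrt_orthogonal_transformation:
  fixes e :: "nat \<Rightarrow> 'a::real_inner"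
  assumes e: "ordered_onb n e" and A: "orthogonal_transformation A"
  shows "(det_wrt n e (A \<circ> e))\<^sup>2 = 1"
proof -
  let ?P = "mat n n (\<lambda>(i, j). A (e j) \<bullet> e i)"
  have "transpose_mat ?P * ?P = 1\<^sub>m n"
  proof (rule eq_matI)
    fix i j
    assume "i < dim_row (1\<^sub>m n :: real mat)" "j < dim_col (1\<^sub>m n :: real mat)"
    then have ij: "i < n" "j < n" by simp_all
    have "A (e i) \<bullet> A (e j) = (if i = j then 1 else 0)"
      using e A ij by (simp add: orthogonal_transformation_def ordered_onb_def)
    then show "(transpose_mat ?P * ?P) $$ (i, j) = 1\<^sub>m n $$ (i, j)"
      using ij ordered_onb_inner[OF e, of "A (e i)" "A (e j)"]
      by (simp add: Matrix.scalar_prod_def lessThan_atLeast0 inner_commute)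
  qed simp_all
  then have "Determinant.det (transpose_mat ?P) * Determinant.det ?P = 1"
    by (subst det_mult[where n = n, symmetric]) auto
  then show ?thesis
    by (simp add: det_wrt_def power2_eq_square det_transpose[where n = n])
qed

section \<open>The frame of derivatives and the congruence of the curves\<close>

lemma curve_deriv_has_vector_derivative:
  assumes "n_times_continuously_differentiable n a b c" "k < n" "t \<in> {a..b}"
  shows "(curve_deriv a b k c has_vector_derivative curve_deriv a b (Suc k) c t) (at t within {a..b})"
  using assms
  by (auto simp: n_times_continuously_differentiable_def differentiable_on_def
      vector_derivative_works curve_deriv_def)

text \<open>Shifts the orders 1 to \<open>n\<close> to the indices below \<open>n\<close> used by
  \<open>det_wrt\<close>; spanning then follows by counting.\<close>

lemma strongly_regular_span:
  fixes e :: "nat \<Rightarrow> 'a::real_inner" and c :: "real \<Rightarrow> 'a"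
  assumes e: "ordered_onb n e" and c: "strongly_regular n a b c" and t: "t \<in> {a..b}"
  defines "V \<equiv> \<lambda>k. curve_deriv a b (Suc k) c t"
  shows "inj_on V {..<n}" "independent (V ` {..<n})" "span (V ` {..<n}) = UNIV"
proof -
  have "inj_on ((\<lambda>k. curve_deriv a b k c t) \<circ> Suc) {..<n}"
    using c t by (intro comp_inj_on) (auto simp: strongly_regular_def image_Suc_lessThan)
  then show inj: "inj_on V {..<n}" by (simp add: V_def comp_def)
  have "V ` {..<n} = (\<lambda>k. curve_deriv a b k c t) ` {1..n}"
    unfolding V_def image_Suc_lessThan[symmetric] image_image ..
  then show indep: "independent (V ` {..<n})"
    using c t by (simp add: strongly_regular_def)
  show "span (V ` {..<n}) = UNIV"
    by (rule span_eq_UNIV_if_card_eq[OF e indep]) (auto simp: card_image[OF inj])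
qed

theorem theorem3:
  fixes e :: "nat \<Rightarrow> 'a::real_inner"
    and c c' :: "real \<Rightarrow> 'a"
    and a b :: real
    and n :: nat
  assumes "ordered_onb n e"
    and "a < b"
    and "strongly_regular n a b c"
    and "strongly_regular n a b c'"
    and "\<forall>k\<in>{1..n}. \<forall>t\<in>{a..b}. norm (curve_deriv a b k c' t) = norm (curve_deriv a b k c t)"
  shows "(\<exists>g. euclidean_isometry g \<and> (\<forall>t\<in>{a..b}. c' t = g (c t))) \<and>
    (curve_sgn n e a b c' = curve_sgn n e a b c \<longrightarrow>
      (\<exists>g. orientation_preserving_isometry n e g \<and> (\<forall>t\<in>{a..b}. c' t = g (c t))))"
proof -
  note e = assms(1) and c = assms(3) and c' = assms(4)
  have diff: "n_times_continuously_differentiable n a b c"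
    "n_times_continuously_differentiable n a b c'"
    using c c' by (auto simp: strongly_regular_def)
  \<comment> \<open>Index \<open>k\<close> stands for order \<open>k + 1\<close>, so
    \<open>V (n - 1)\<close> is the merely continuous derivative of order \<open>n\<close>.\<close>
  define V where "V k = curve_deriv a b (Suc k) c" for k
  define W where "W k = curve_deriv a b (Suc k) c'" for k
  have V: "(V k has_vector_derivative V (Suc k) t) (at t within {a..b})"
    and W: "(W k has_vector_derivative W (Suc k) t) (at t within {a..b})"
    if "Suc k < n" "t \<in> {a..b}" for k t
    using that diff by (auto simp: V_def W_def intro: curve_deriv_has_vector_derivative)
  have cont: "continuous_on {a..b} (V k)" "continuous_on {a..b} (W k)" if "k < n" for k
    using that diff by (auto simp: V_def W_def intro: continuous_on_curve_deriv)
  have norms: "norm (W k t) = norm (V k t)" if "k < n" "t \<in> {a..b}" for k t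
    using assms(5) that by (simp add: V_def W_def)
  have gram: "W i t \<bullet> W j t = V i t \<bullet> V j t" if "i < n" "j < n" "t \<in> {a..b}" for i j t
    using gram_determined_by_norms[of a b n V W i j t] V W norms \<open>a < b\<close> that by blast
  have span: "span ((\<lambda>k. V k t) ` {..<n}) = UNIV" "span ((\<lambda>k. W k t) ` {..<n}) = UNIV"
    if "t \<in> {a..b}" for t
    using strongly_regular_span(3)[OF e c that] strongly_regular_span(3)[OF e c' that]
    by (simp_all add: V_def W_def)
  have "\<exists>A. orthogonal_transformation A \<and> (\<forall>k<n. A (V k t) = W k t)" if t: "t \<in> {a..b}" for t
    using orthogonal_transformation_of_gram_eq[of "\<lambda>k. V k t" "{..<n}" "\<lambda>k. W k t"]
      strongly_regular_span[OF e c t] gram t unfolding V_def by (metis lessThan_iff)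
  then obtain A where "\<forall>t\<in>{a..b}. orthogonal_transformation (A t) \<and> (\<forall>k<n. A t (V k t) = W k t)"
    by metis
  then have A: "orthogonal_transformation (A t)"
    and AV: "\<And>k. k < n \<Longrightarrow> A t (V k t) = W k t" if "t \<in> {a..b}" for t
    using that by auto
  obtain A0 where A0: "\<And>t. t \<in> {a..b} \<Longrightarrow> A t = A0"
    using moving_isometry_constant[of n e a b V W A] e V W cont span A AV by blast
  have a: "a \<in> {a..b}" using \<open>a < b\<close> by simp
  have orth: "orthogonal_transformation A0" using A[OF a] A0[OF a] by simp
  then have lin: "bounded_linear A0" by (rule bounded_linear_orthogonal_transformation)
  have "((\<lambda>t. c' t - A0 (c t)) has_vector_derivative 0) (at t within {a..b})"
    if t: "t \<in> {a..b}" for t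
  proof (cases n)
    \<comment> \<open>Now the curves are only known to be continuous, but the space consists of 0
      alone.\<close>
    case 0
    then have "x = 0" for x :: 'a using ordered_onb_expansion[OF e, of x] by simp
    then have "(\<lambda>t. c' t - A0 (c t)) = (\<lambda>t. 0)" by blast
    then show ?thesis by simp
  next
    case (Suc m)
    have "(c has_vector_derivative V 0 t) (at t within {a..b})"
      "(c' has_vector_derivative W 0 t) (at t within {a..b})"
      using curve_deriv_has_vector_derivative[OF diff(1), of 0 t]
        curve_deriv_has_vector_derivative[OF diff(2), of 0 t] Suc t
      by (simp_all add: V_def W_def curve_deriv_def)
    then have "((\<lambda>t. c' t - A0 (c t)) has_vector_derivative W 0 t - A0 (V 0 t)) (at t within {a..b})"
      by (intro has_vector_derivative_diff bounded_linear.has_vector_derivative[OF lin])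
    then show ?thesis using AV[OF t, of 0] A0[OF t] Suc by simp
  qed
  then obtain w where w: "\<And>t. t \<in> {a..b} \<Longrightarrow> c' t - A0 (c t) = w"
    using has_vector_derivative_zero_constant[of "{a..b}" "\<lambda>t. c' t - A0 (c t)"]
    by (metis convex_real_interval(5))
  then have g: "\<forall>t\<in>{a..b}. c' t = A0 (c t) + w" by (metis add.commute diff_add_cancel)
  \<comment> \<open>Comparing the two frames at the single time \<open>a\<close> suffices: equal
    nonzero signs force the determinant of \<open>A0\<close>, which is 1 or -1, to be
    positive.\<close>
  have "det_wrt n e (A0 \<circ> e) = 1" if "curve_sgn n e a b c' = curve_sgn n e a b c"
  proof -
    have "det_wrt n e (\<lambda>k. W k a) = det_wrt n e (A0 \<circ> (\<lambda>k. V k a))"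
      \<comment> \<open>The two families agree only at indices below \<open>n\<close>, so the
        matrices are compared and not the functions.\<close>
      unfolding det_wrt_def using AV[OF a] A0[OF a] by (intro arg_cong[of _ _ Determinant.det] eq_matI) auto
    also have "\<dots> = det_wrt n e (A0 \<circ> e) * det_wrt n e (\<lambda>k. V k a)"
      using orth by (intro det_wrt_linear[OF e]) (simp add: orthogonal_transformation_def)
    finally have "sgn (det_wrt n e (\<lambda>k. W k a)) =
        sgn (det_wrt n e (A0 \<circ> e)) * sgn (det_wrt n e (\<lambda>k. V k a))"
      by (simp add: sgn_mult)
    moreover have "sgn (det_wrt n e (\<lambda>k. W k a)) = sgn (det_wrt n e (\<lambda>k. V k a))"
      using that curve_sgn_eq[OF e c a] curve_sgn_eq[OF e c' a] by (simp add: V_def W_def)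
    moreover have "det_wrt n e (\<lambda>k. V k a) \<noteq> 0"
      using det_wrt_strongly_regular_nonzero[OF e c a] by (simp add: V_def)
    ultimately have "sgn (det_wrt n e (A0 \<circ> e)) = 1" by (simp add: sgn_zero_iff)
    moreover have "det_wrt n e (A0 \<circ> e) = 1 \<or> det_wrt n e (A0 \<circ> e) = - 1"
      using det_wrt_orthogonal_transformation[OF e orth] by (simp add: power2_eq_1_iff)
    ultimately show ?thesis by auto
  qed
  then show ?thesis
    using orth g unfolding euclidean_isometry_def orientation_preserving_isometry_def
    by blast
qed

end
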